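(* Let $\mathfrak g$ be a unimodular Lie algebra. Then the set of closed 1-forms $\theta\in\mathfrak g^*$ for which there exist an inner product $g$ on $\mathfrak g$ and a subspace $\mathfrak u\subset\mathfrak g$ such that $(g,\theta,\mathfrak u)$ is a proper LCP structure on $\mathfrak g$ is finite.
   Context: All Lie algebras are real and finite-dimensional. Let $\mathfrak g$ be a Lie algebra with an inner product $g$. For $x\in\mathfrak g$, $\nabla^g_x\in\mathfrak{so}(\mathfrak g)$ is given by $g(\nabla^g_xy,z)=\frac12\big(g([x,y],z)-g([x,z],y)-g([y,z],x)\big)$. For $\theta\in\mathfrak g^*$ with $g$-dual vector $\theta^\sharp$, set $\nabla^\theta_xy:=\nabla^g_xy+\theta(x)y+\theta(y)x-g(x,y)\theta^\sharp$. A 1-form $\theta\in\mathfrak g^*$ is closed if it vanishes on $\mathfrak g'=[\mathfrak g,\mathfrak g]$. A subspace $\mathfrak u\subset\mathfrak g$ is $\nabla^\theta$-flat if $\nabla^\theta_x\mathfrak u\subset\mathfrak u$ for all $x\in\mathfrak g$ and $x\mapsto\nabla^\theta_x|_{\mathfrak u}$ is a Lie algebra representation $\mathfrak g\to\mathfrak{gl}(\mathfrak u)$. An LCP structure on $\mathfrak g$ is a triple $(g,\theta,\mathfrak u)$ with $g$ an inner product, $\theta\ne0$ a closed 1-form (its Lee form) and $\mathfrak u\neq0$ a $\nabla^\theta$-flat subspace. It is proper if $\mathfrak u\subsetneq\mathfrak g$. A Lie algebra $\mathfrak g$ is unimodular if $\mathrm{tr}(\mathrm{ad}_x)=0$ for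 all $x\in\mathfrak g$. *)

theory Defs
  imports "HOL-Analysis.Analysis"
begin

section \<open>Finite-dimensional real Lie algebras\<close>

text \<open>The underlying space is a whole type of class real_vector, which carries neither a
  preferred inner product nor a topology and may be zero-dimensional.\<close>

locale fd_lie_algebra =
  fixes bracket :: "'a::real_vector \<Rightarrow> 'a \<Rightarrow> 'a"
  assumes finite_dim: "\<exists>B::'a set. finite B \<and> span B = UNIV"
    and bilinear: "bilinear bracket"
    and alternating: "bracket x x = 0"
    and jacobi: "bracket x (bracket y z) + bracket y (bracket z x) + bracket z (bracket x y) = 0"

definition derived_algebra :: "('a::real_vector \<Rightarrow> 'a \<Rightarrow> 'a) \<Rightarrow> 'a set" where
  "derived_algebra bracket = span {bracket x y | x y. True}"

text \<open>Independent of the chosen basis, see the lemma \<open>trace_endo_eq\<close> below.\<close>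

definition trace_endo :: "('a::real_vector \<Rightarrow> 'a) \<Rightarrow> real" where
  "trace_endo f =
     (let B = (SOME B. independent B \<and> span B = UNIV) in \<Sum>b\<in>B. representation B (f b) b)"

definition unimodular :: "('a::real_vector \<Rightarrow> 'a \<Rightarrow> 'a) \<Rightarrow> bool" where
  "unimodular bracket \<longleftrightarrow> (\<forall>x. trace_endo (bracket x) = 0)"

definition closed_1form :: "('a::real_vector \<Rightarrow> 'a \<Rightarrow> 'a) \<Rightarrow> ('a \<Rightarrow> real) \<Rightarrow> bool" where
  "closed_1form bracket \<theta> \<longleftrightarrow> linear \<theta> \<and> (\<forall>x\<in>derived_algebra bracket. \<theta> x = 0)"

text \<open>The map \<open>\<rho>\<close> is only looked at on \<open>U\<close>, and need not vanish or be linear elsewhere.\<close>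

definition lie_representation_on ::
    "('a::real_vector \<Rightarrow> 'a \<Rightarrow> 'a) \<Rightarrow> 'b::real_vector set \<Rightarrow> ('a \<Rightarrow> 'b \<Rightarrow> 'b) \<Rightarrow> bool" where
  "lie_representation_on bracket U \<rho> \<longleftrightarrow>
     (\<forall>x. \<forall>u\<in>U. \<rho> x u \<in> U) \<and>
     (\<forall>x a b. \<forall>u\<in>U. \<forall>v\<in>U. \<rho> x (a *\<^sub>R u + b *\<^sub>R v) = a *\<^sub>R \<rho> x u + b *\<^sub>R \<rho> x v) \<and>
     (\<forall>u\<in>U. linear (\<lambda>x. \<rho> x u)) \<and>
     (\<forall>x y. \<forall>u\<in>U. \<rho> (bracket x y) u = \<rho> x (\<rho> y u) - \<rho> y (\<rho> x u))"


section \<open>Inner products and connections\<close>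

definition inner_product :: "('a::real_vector \<Rightarrow> 'a \<Rightarrow> real) \<Rightarrow> bool" where
  "inner_product g \<longleftrightarrow> bilinear g \<and> (\<forall>x y. g x y = g y x) \<and> (\<forall>x. x \<noteq> 0 \<longrightarrow> g x x > 0)"

text \<open>The definite description is meaningful for every linear \<open>\<theta>\<close>, see the lemma
  \<open>g_sharp\<close> below.\<close>

definition sharp :: "('a::real_vector \<Rightarrow> 'a \<Rightarrow> real) \<Rightarrow> ('a \<Rightarrow> real) \<Rightarrow> 'a" where
  "sharp g \<theta> = (THE v. \<forall>z. g v z = \<theta> z)"

definition levi_civita ::
    "('a::real_vector \<Rightarrow> 'a \<Rightarrow> 'a) \<Rightarrow> ('a \<Rightarrow> 'a \<Rightarrow> real) \<Rightarrow> 'a \<Rightarrow> 'a \<Rightarrow> 'a" where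
  "levi_civita bracket g x y =
     sharp g (\<lambda>z. 1/2 * (g (bracket x y) z - g (bracket x z) y - g (bracket y z) x))"

definition weyl_connection ::
    "('a::real_vector \<Rightarrow> 'a \<Rightarrow> 'a) \<Rightarrow> ('a \<Rightarrow> 'a \<Rightarrow> real) \<Rightarrow> ('a \<Rightarrow> real) \<Rightarrow> 'a \<Rightarrow> 'a \<Rightarrow> 'a" where
  "weyl_connection bracket g \<theta> x y =
     levi_civita bracket g x y + \<theta> x *\<^sub>R y + \<theta> y *\<^sub>R x - g x y *\<^sub>R sharp g \<theta>"

definition flat_subspace ::
    "('a::real_vector \<Rightarrow> 'a \<Rightarrow> 'a) \<Rightarrow> ('a \<Rightarrow> 'a \<Rightarrow> real) \<Rightarrow> ('a \<Rightarrow> real) \<Rightarrow> 'a set \<Rightarrow> bool" where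
  "flat_subspace bracket g \<theta> U \<longleftrightarrow>
     subspace U \<and> lie_representation_on bracket U (weyl_connection bracket g \<theta>)"

definition LCP_structure ::
    "('a::real_vector \<Rightarrow> 'a \<Rightarrow> 'a) \<Rightarrow> ('a \<Rightarrow> 'a \<Rightarrow> real) \<Rightarrow> ('a \<Rightarrow> real) \<Rightarrow> 'a set \<Rightarrow> bool" where
  "LCP_structure bracket g \<theta> U \<longleftrightarrow>
     inner_product g \<and>
     closed_1form bracket \<theta> \<and> \<theta> \<noteq> (\<lambda>x. 0) \<and>
     flat_subspace bracket g \<theta> U \<and> U \<noteq> {0}"

definition proper_LCP_structure ::
    "('a::real_vector \<Rightarrow> 'a \<Rightarrow> 'a) \<Rightarrow> ('a \<Rightarrow> 'a \<Rightarrow> real) \<Rightarrow> ('a \<Rightarrow> real) \<Rightarrow> 'a set \<Rightarrow> bool" where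
  "proper_LCP_structure bracket g \<theta> U \<longleftrightarrow> LCP_structure bracket g \<theta> U \<and> U \<noteq> UNIV"


section \<open>Well-definedness\<close>

lemma independent_spanning_finite:
  assumes "\<exists>B::'a::real_vector set. finite B \<and> span B = UNIV"
    and "independent (C::'a set)"
  shows "finite C"
proof -
  from assms(1) obtain B :: "'a set" where B: "finite B" "span B = UNIV" by blast
  show ?thesis using independent_span_bound[OF B(1) assms(2)] B(2) by simp
qed

lemma trace_basis_independent:
  fixes f :: "'a::real_vector \<Rightarrow> 'a"
  assumes f: "linear f"
    and B: "independent B" "span B = UNIV" "finite B"
    and C: "independent C" "span C = UNIV" "finite C"
  shows "(\<Sum>b\<in>B. representation B (f b) b) = (\<Sum>c\<in>C. representation C (f c) c)"
proof -
  have exp: "(\<Sum>d\<in>D. representation D v d *\<^sub>R d) = v"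
    if "independent D" "span D = UNIV" "finite D" for D and v :: 'a
    using real_vector.sum_representation_eq[OF that(1) _ that(3) subset_refl, of v] that(2) by simp
  have lin: "representation D (f (\<Sum>e\<in>E. s e *\<^sub>R e)) d = (\<Sum>e\<in>E. s e * representation D (f e) d)"
    if D: "independent D" "span D = UNIV" for D E :: "'a set" and s d
  proof -
    have "f (\<Sum>e\<in>E. s e *\<^sub>R e) = (\<Sum>e\<in>E. s e *\<^sub>R f e)"
      by (simp add: linear_sum[OF f] linear_scale[OF f])
    then show ?thesis
      using D by (simp add: real_vector.representation_sum real_vector.representation_scale)
  qed
  have lin': "representation B (\<Sum>c\<in>C. s c *\<^sub>R c) b = (\<Sum>c\<in>C. s c * representation B c b)" for s b
    using B by (simp add: real_vector.representation_sum real_vector.representation_scale)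
  have "representation B (f b) b = (\<Sum>c\<in>C. representation C (f b) c * representation B c b)" for b
    using lin'[of "representation C (f b)" b] unfolding exp[OF C] .
  then have "(\<Sum>b\<in>B. representation B (f b) b)
      = (\<Sum>b\<in>B. \<Sum>c\<in>C. representation C (f b) c * representation B c b)"
    by simp
  also have "\<dots> = (\<Sum>c\<in>C. \<Sum>b\<in>B. representation B c b * representation C (f b) c)"
    by (subst sum.swap) (simp add: mult.commute)
  also have "\<dots> = (\<Sum>c\<in>C. representation C (f (\<Sum>b\<in>B. representation B c b *\<^sub>R b)) c)"
    unfolding lin[OF C(1,2)] by (rule refl)
  also have "\<dots> = (\<Sum>c\<in>C. representation C (f c) c)"
    by (simp add: exp[OF B])
  finally show ?thesis .
qed

lemma trace_endo_eq:
  fixes f :: "'a::real_vector \<Rightarrow> 'a"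
  assumes fd: "\<exists>B::'a set. finite B \<and> span B = UNIV"
    and f: "linear f" and C: "independent C" "span C = UNIV"
  shows "trace_endo f = (\<Sum>c\<in>C. representation C (f c) c)"
proof -
  define B where "B = (SOME B::'a set. independent B \<and> span B = UNIV)"
  have "independent B \<and> span B = UNIV"
    unfolding B_def by (rule someI[of _ C]) (use C in simp)
  then show ?thesis
    unfolding trace_endo_def B_def[symmetric] Let_def
    using trace_basis_independent[OF f, of B C] C independent_spanning_finite[OF fd] by blast
qed

lemma riesz_on_finite:
  fixes g :: "'a::real_vector \<Rightarrow> 'a \<Rightarrow> real"
  assumes g: "inner_product g" and "finite B" and "linear \<theta>"
  shows "\<exists>v\<in>span B. \<forall>b\<in>B. g v b = \<theta> b"
  using assms(2,3)
proof (induction B arbitrary: \<theta> rule: finite_induct)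
  case empty
  then show ?case by (auto intro: span_zero)
next
  case (insert b B)
  have bl: "bilinear g" and sym: "\<And>x y. g x y = g y x" and pos: "\<And>x. x \<noteq> 0 \<Longrightarrow> g x x > 0"
    using g by (auto simp: inner_product_def)
  have lin: "linear (g x)" for x using bl by (simp add: bilinear_def)
  obtain p where p: "p \<in> span B" "\<forall>c\<in>B. g p c = g b c" using insert.IH[OF lin] by blast
  obtain v where v: "v \<in> span B" "\<forall>c\<in>B. g v c = \<theta> c" using insert.IH[OF insert.prems] by blast
  define e where "e = b - p"
  have ext: "g w x = h x" if "\<forall>c\<in>B. g w c = h c" "linear h" "x \<in> span B" for w h x
    using linear_eq_on_span[OF lin that(2), of B w x] that by blast
  have e0: "g e x = 0" if "x \<in> span B" for x
    using ext[OF p(2) lin that] by (simp add: e_def bilinear_lsub[OF bl])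
  have sub: "span B \<subseteq> span (insert b B)" by (intro span_mono) auto
  show ?case
  proof (cases "e = 0")
    case True
    then have "b \<in> span B" using p(1) by (simp add: e_def)
    then have "g v b = \<theta> b" using ext[OF v(2) insert.prems] by blast
    then show ?thesis using v sub by blast
  next
    case False
    define t where "t = (\<theta> b - g v b) / g e e"
    have "b = e + p" by (simp add: e_def)
    then have "g e b = g e e" using e0[OF p(1)] by (metis bilinear_radd[OF bl] add.right_neutral)
    then have "g (v + t *\<^sub>R e) b = \<theta> b"
      using pos[OF False] by (simp add: bilinear_ladd[OF bl] bilinear_lmul[OF bl] t_def)
    moreover have "\<forall>c\<in>B. g (v + t *\<^sub>R e) c = \<theta> c"
      using v(2) e0 by (simp add: bilinear_ladd[OF bl] bilinear_lmul[OF bl] span_base)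
    moreover have "e \<in> span (insert b B)"
      unfolding e_def using p(1) sub by (intro span_diff) (auto intro: span_base)
    then have "v + t *\<^sub>R e \<in> span (insert b B)"
      using v(1) sub by (intro span_add span_scale) auto
    ultimately show ?thesis by blast
  qed
qed

lemma g_sharp:
  fixes g :: "'a::real_vector \<Rightarrow> 'a \<Rightarrow> real"
  assumes fd: "\<exists>B::'a set. finite B \<and> span B = UNIV"
    and g: "inner_product g" and \<theta>: "linear \<theta>"
  shows "g (sharp g \<theta>) z = \<theta> z"
proof -
  have bl: "bilinear g" and pos: "\<And>x. x \<noteq> 0 \<Longrightarrow> g x x > 0"
    using g by (auto simp: inner_product_def)
  obtain B :: "'a set" where B: "finite B" "span B = UNIV" using fd by blast
  obtain v where "\<forall>b\<in>B. g v b = \<theta> b" using riesz_on_finite[OF g B(1) \<theta>] by blast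
  then have v: "\<forall>z. g v z = \<theta> z"
    using linear_eq_on_span[of "g v" \<theta> B] \<theta> bl B(2) by (auto simp: bilinear_def)
  have "w = v" if "\<forall>z. g w z = \<theta> z" for w
  proof (rule ccontr)
    assume "w \<noteq> v"
    then have "g (w - v) (w - v) > 0" using pos by simp
    then show False using that v by (simp add: bilinear_lsub[OF bl])
  qed
  then have "\<forall>z. g (sharp g \<theta>) z = \<theta> z"
    unfolding sharp_def using theI[of "\<lambda>w. \<forall>z. g w z = \<theta> z" v] v by blast
  then show ?thesis by simp
qed

lemma (in fd_lie_algebra) g_levi_civita:
  assumes g: "inner_product g"
  shows "g (levi_civita bracket g x y) z
       = 1/2 * (g (bracket x y) z - g (bracket x z) y - g (bracket y z) x)"
proof -
  have bl: "bilinear g" using g by (simp add: inner_product_def)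
  have "linear (\<lambda>z. 1/2 * (g (bracket x y) z - g (bracket x z) y - g (bracket y z) x))"
    by (rule linearI)
       (simp_all add: bilinear_radd[OF bl] bilinear_rmul[OF bl] bilinear_ladd[OF bl]
          bilinear_lmul[OF bl] bilinear_radd[OF bilinear] bilinear_rmul[OF bilinear] algebra_simps)
  then show ?thesis unfolding levi_civita_def by (rule g_sharp[OF finite_dim g])
qed

end

(* Let D be the Weyl connection and U the flat subspace. Unimodularity and a Cauchy-Schwarz estimate
   force \<theta> to vanish on U. A trace argument then shows D x = 0 for x in U, so that U is an ideal on
   which ad y = D y is conformal with factor \<theta> y. The inverse metric of U is therefore an eigenvector of
   the action of ad y on the tensor square of the Lie algebra, with eigenvalue 2 \<theta> y. This operator
   does not depend on the LCP structure, so \<theta> y can take only finitely many values for each y, and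
   a linear form is determined by its values on a basis. *)
theory Submission
  imports Defs "Jordan_Normal_Form.Char_Poly"
begin

section \<open>Orthonormal bases\<close>

locale fd_inner_product =
  fixes g :: "'a::real_vector \<Rightarrow> 'a \<Rightarrow> real"
  assumes finite_dimensional: "\<exists>B::'a set. finite B \<and> span B = UNIV"
    and inner_product_g: "inner_product g"
begin

lemma g_bilinear: "bilinear g"
  and g_sym: "g x y = g y x"
  and g_pos: "x \<noteq> 0 \<Longrightarrow> g x x > 0"
  using inner_product_g by (auto simp: inner_product_def)

lemma g_nonneg: "g x x \<ge> 0"
  using g_pos[of x] bilinear_lzero[OF g_bilinear] by (cases "x = 0") auto

lemma g_eq_0_iff: "g x x = 0 \<longleftrightarrow> x = 0"
  using g_pos[of x] bilinear_lzero[OF g_bilinear, of 0] by (cases "x = 0") auto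

lemmas g_simps = bilinear_ladd[OF g_bilinear] bilinear_radd[OF g_bilinear]
  bilinear_lmul[OF g_bilinear] bilinear_rmul[OF g_bilinear]
  bilinear_lsub[OF g_bilinear] bilinear_rsub[OF g_bilinear]
  bilinear_lneg[OF g_bilinear] bilinear_rneg[OF g_bilinear]
  bilinear_lzero[OF g_bilinear] bilinear_rzero[OF g_bilinear]

lemma linear_g: "linear (g x)" "linear (\<lambda>x. g x y)"
  using g_bilinear by (auto simp: bilinear_def)

lemma g_sum_left: "g (\<Sum>i\<in>I. f i) y = (\<Sum>i\<in>I. g (f i) y)"
  by (rule linear_sum[OF linear_g(2)])

lemma g_nondegenerate:
  assumes "\<And>z. g x z = g y z"
  shows "x = y"
proof -
  have "g (x - y) (x - y) = 0" using assms by (simp add: g_simps)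
  then show ?thesis by (simp add: g_eq_0_iff)
qed

text \<open>The spanning condition is stated as the Fourier expansion, the form in which traces are
  computed from it.\<close>

definition onb :: "'a set \<Rightarrow> 'a set \<Rightarrow> bool" where
  "onb E U \<longleftrightarrow> finite E \<and> E \<subseteq> U \<and> (\<forall>e\<in>E. \<forall>e'\<in>E. g e e' = (if e = e' then 1 else 0)) \<and>
     (\<forall>x\<in>U. (\<Sum>e\<in>E. g x e *\<^sub>R e) = x)"

lemma
  assumes "onb E U"
  shows onb_finite: "finite E"
    and onb_mem: "e \<in> E \<Longrightarrow> e \<in> U"
    and onb_g: "e \<in> E \<Longrightarrow> e' \<in> E \<Longrightarrow> g e e' = (if e = e' then 1 else 0)"
    and onb_expand: "x \<in> U \<Longrightarrow> (\<Sum>e\<in>E. g x e *\<^sub>R e) = x"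
  using assms by (auto simp: onb_def)

lemma g_sum_orthonormal:
  assumes "finite E" "\<forall>e\<in>E. \<forall>e'\<in>E. g e e' = (if e = e' then 1 else 0)" "d \<in> E"
  shows "g (\<Sum>e\<in>E. c e *\<^sub>R e) d = c d"
proof -
  have "g (\<Sum>e\<in>E. c e *\<^sub>R e) d = (\<Sum>e\<in>E. if e = d then c e else 0)"
    unfolding g_sum_left using assms by (intro sum.cong) (auto simp: g_simps)
  then show ?thesis using assms by simp
qed

text \<open>Gram-Schmidt, one vector at a time.\<close>

lemma orthonormal_spanning:
  assumes "finite B"
  shows "\<exists>E. finite E \<and> (\<forall>e\<in>E. \<forall>e'\<in>E. g e e' = (if e = e' then 1 else 0)) \<and> span E = span B"
  using assms
proof (induction B rule: finite_induct)
  case empty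
  then show ?case by (intro exI[of _ "{}"]) simp
next
  case (insert b B)
  then obtain E where E: "finite E" "\<forall>e\<in>E. \<forall>e'\<in>E. g e e' = (if e = e' then 1 else 0)"
    "span E = span B" by blast
  define p where "p = (\<Sum>e\<in>E. g b e *\<^sub>R e)"
  have p: "p \<in> span E" unfolding p_def by (intro span_sum span_scale span_base)
  have orth: "g (b - p) e = 0" if "e \<in> E" for e
    using g_sum_orthonormal[OF E(1,2) that, of "g b"] by (simp add: p_def g_simps)
  have span_b: "span (insert b B) = span (insert b E)"
    by (simp add: span_insert E(3))
  show ?case
  proof (cases "b = p")
    case True
    then have "span E = span (insert b B)" using p span_b by (simp add: span_redundant)
    with E(1,2) show ?thesis by (intro exI[of _ E] conjI)
  next
    case False
    define n where "n = sqrt (g (b - p) (b - p))"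
    have n: "n > 0" "n * n = g (b - p) (b - p)" using g_pos[of "b - p"] False by (auto simp: n_def)
    define d where "d = (1 / n) *\<^sub>R (b - p)"
    have "g d d = 1" using n by (simp add: d_def g_simps(3,4) n(2)[symmetric])
    moreover have "g d e = 0" "g e d = 0" if "e \<in> E" for e
      using orth[OF that] by (simp_all add: d_def g_simps(3,4) g_sym[of e])
    moreover have "span (insert d E) = span (insert b E)"
    proof -
      have b: "b = n *\<^sub>R d + p" using n by (simp add: d_def)
      have "d \<in> span (insert b E)" unfolding d_def using p span_mono[of E "insert b E"]
        by (intro span_scale span_diff) (auto intro: span_base)
      moreover have "b \<in> span (insert d E)" unfolding b using p span_mono[of E "insert d E"]
        by (intro span_add span_scale) (auto intro: span_base)
      ultimately show ?thesis
        by (intro antisym span_minimal) (auto intro: span_base)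
    qed
    ultimately show ?thesis
      using E span_b by (intro exI[of _ "insert d E"]) auto
  qed
qed

lemma onb_exists:
  assumes "subspace U"
  shows "\<exists>E. onb E U"
proof -
  obtain B where B: "B \<subseteq> U" "independent B" "U \<subseteq> span B" "card B = dim U"
    by (rule real_vector.basis_exists)
  have "finite B" by (rule independent_spanning_finite[OF finite_dimensional B(2)])
  then obtain E where E: "finite E" "\<forall>e\<in>E. \<forall>e'\<in>E. g e e' = (if e = e' then 1 else 0)"
    "span E = span B" using orthonormal_spanning[of B] by auto
  have U: "span E = U" using B E(3) assms span_minimal by blast
  have "(\<Sum>e\<in>E. g x e *\<^sub>R e) = x" if "x \<in> U" for x
  proof -
    have "x \<in> range (\<lambda>c. \<Sum>e\<in>E. c e *\<^sub>R e)"
      using that U span_finite[OF E(1)] by simp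
    then obtain c where c: "x = (\<Sum>e\<in>E. c e *\<^sub>R e)" by blast
    show ?thesis unfolding c
      by (intro sum.cong refl arg_cong[of _ _ "\<lambda>r. r *\<^sub>R _"] g_sum_orthonormal[OF E(1,2)])
  qed
  moreover have "E \<subseteq> U" using U span_superset by auto
  ultimately show ?thesis using E(1,2) unfolding onb_def by (intro exI[of _ E]) simp
qed

lemma onb_trace:
  assumes C: "onb C UNIV" and f: "linear f"
  shows "trace_endo f = (\<Sum>c\<in>C. g (f c) c)"
proof -
  note [simp] = onb_finite[OF C] onb_g[OF C] onb_expand[OF C]
  have ind: "independent C"
  proof (rule independent_if_scalars_zero)
    fix c x assume "(\<Sum>x\<in>C. c x *\<^sub>R x) = 0" "x \<in> C"
    then show "c x = 0"
      using g_sum_orthonormal[of C x c] by (simp add: g_simps)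
  qed simp
  have "(\<Sum>e\<in>C. g x e *\<^sub>R e) \<in> span C" for x
    by (intro span_sum span_scale span_base)
  then have "x \<in> span C" for x by simp
  then have span: "span C = UNIV" by blast
  have "representation C v c = g v c" if "c \<in> C" for v c
  proof -
    have "(\<Sum>b\<in>C. representation C v b *\<^sub>R b) = v"
      by (rule real_vector.sum_representation_eq) (use ind span in auto)
    then show ?thesis using g_sum_orthonormal[of C c "representation C v"] that by simp
  qed
  then show ?thesis
    unfolding trace_endo_eq[OF finite_dimensional f ind span] by simp
qed

section \<open>Orthogonal complements and traces on a subspace\<close>

definition orthogonal_complement :: "'a set \<Rightarrow> 'a set" where
  "orthogonal_complement U = {y. \<forall>x\<in>U. g x y = 0}"

lemma subspace_orthogonal_complement: "subspace (orthogonal_complement U)"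
  by (auto simp: subspace_def orthogonal_complement_def g_simps)

lemma onb_union_complement:
  assumes E: "onb E U" and F: "onb F (orthogonal_complement U)"
  shows "E \<inter> F = {}" and "onb (E \<union> F) UNIV"
proof -
  note [simp] = onb_finite[OF E] onb_finite[OF F]
  have orth: "g e f = 0" if "e \<in> U" "f \<in> F" for e f
    using that onb_mem[OF F] by (auto simp: orthogonal_complement_def)
  show disj: "E \<inter> F = {}"
    using orth onb_mem[OF E] onb_g[OF E] by fastforce
  have "(\<Sum>e\<in>E \<union> F. g x e *\<^sub>R e) = x" for x
  proof -
    define p where "p = (\<Sum>e\<in>E. g x e *\<^sub>R e)"
    have "g e (x - p) = 0" if "e \<in> E" for e
      using g_sum_orthonormal[of E e "g x"] onb_g[OF E] that
      by (simp add: p_def g_simps g_sym[of e])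
    then have "g u (x - p) = 0" if "u \<in> U" for u
      by (subst onb_expand[OF E that, symmetric]) (simp add: g_sum_left g_simps)
    then have q: "x - p \<in> orthogonal_complement U" by (simp add: orthogonal_complement_def)
    have "g p f = 0" if "f \<in> F" for f
      using orth[OF onb_mem[OF E] that] by (simp add: p_def g_sum_left g_simps)
    then have "(\<Sum>f\<in>F. g x f *\<^sub>R f) = x - p"
      by (subst onb_expand[OF F q, symmetric]) (simp add: g_simps)
    then show ?thesis by (simp add: sum.union_disjoint[OF _ _ disj] p_def)
  qed
  moreover have "g e e' = (if e = e' then 1 else 0)" if "e \<in> E \<union> F" "e' \<in> E \<union> F" for e e'
  proof -
    consider "e \<in> E" "e' \<in> E" | "e \<in> F" "e' \<in> F" | "e \<in> E" "e' \<in> F" | "e \<in> F" "e' \<in> E"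
      using \<open>e \<in> E \<union> F\<close> \<open>e' \<in> E \<union> F\<close> by blast
    then show ?thesis
    proof cases
      case 3
      then show ?thesis using orth[OF onb_mem[OF E]] disj by auto
    next
      case 4
      then show ?thesis using orth[OF onb_mem[OF E], of e' e] disj by (auto simp: g_sym[of e])
    qed (simp_all add: onb_g[OF E] onb_g[OF F])
  qed
  ultimately show "onb (E \<union> F) UNIV" by (simp add: onb_def)
qed

text \<open>Both sides are traces on the invariant subspace \<open>U\<close>; expanding in
  \<open>E\<close> gives the same double sum of products of matrix entries.\<close>

lemma onb_trace_commute:
  assumes E: "onb E U" and P: "linear P" "\<And>x. x \<in> U \<Longrightarrow> P x \<in> U"
    and Q: "linear Q" "\<And>x. x \<in> U \<Longrightarrow> Q x \<in> U"
  shows "(\<Sum>e\<in>E. g (P (Q e)) e) = (\<Sum>e\<in>E. g (Q (P e)) e)"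
proof -
  have expand: "g (P (Q e)) e = (\<Sum>d\<in>E. g (Q e) d * g (P d) e)"
    if "linear P" "\<And>x. x \<in> U \<Longrightarrow> Q x \<in> U" "e \<in> E" for P Q e
  proof -
    have "P (Q e) = P (\<Sum>d\<in>E. g (Q e) d *\<^sub>R d)"
      using onb_expand[OF E that(2)[OF onb_mem[OF E that(3)]]] by simp
    also have "\<dots> = (\<Sum>d\<in>E. g (Q e) d *\<^sub>R P d)"
      by (simp add: linear_sum[OF that(1)] linear_cmul[OF that(1)])
    finally show ?thesis by (simp add: g_sum_left g_simps(3))
  qed
  have "(\<Sum>e\<in>E. g (P (Q e)) e) = (\<Sum>e\<in>E. \<Sum>d\<in>E. g (Q e) d * g (P d) e)"
    by (intro sum.cong refl expand[OF P(1) Q(2)])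
  also have "\<dots> = (\<Sum>e\<in>E. \<Sum>d\<in>E. g (P e) d * g (Q d) e)"
    by (subst sum.swap) (simp add: mult.commute)
  also have "\<dots> = (\<Sum>e\<in>E. g (Q (P e)) e)"
    by (intro sum.cong refl expand[OF Q(1) P(2), symmetric])
  finally show ?thesis .
qed

text \<open>In terms of \<open>E\<close>, the tensor \<open>\<Sum> e \<otimes> e\<close> is the inverse metric of the span of \<open>E\<close>; a
  conformal map with factor \<open>c\<close> acts on it as multiplication by \<open>2c\<close>.\<close>

lemma conformal_sum:
  assumes E: "onb E U" and T: "\<And>x. x \<in> U \<Longrightarrow> T x \<in> U"
    and conformal: "\<And>x y. x \<in> U \<Longrightarrow> y \<in> U \<Longrightarrow> g (T x) y + g x (T y) = 2 * c * g x y"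
    and B: "bilinear B"
  shows "(\<Sum>e\<in>E. B (T e) e + B e (T e)) = 2 * c * (\<Sum>e\<in>E. B e e :: real)"
proof -
  have l: "B (T e) x = (\<Sum>d\<in>E. g (T e) d * B d x)"
    and r: "B x (T e) = (\<Sum>d\<in>E. g (T e) d * B x d)" if "e \<in> E" for e x
  proof -
    have lin: "linear (\<lambda>y. B y x)" "linear (B x)" using B by (auto simp: bilinear_def)
    have T_e: "T e = (\<Sum>d\<in>E. g (T e) d *\<^sub>R d)"
      using onb_expand[OF E T[OF onb_mem[OF E that]]] by simp
    show "B (T e) x = (\<Sum>d\<in>E. g (T e) d * B d x)"
      by (subst T_e) (simp add: linear_sum[OF lin(1)] linear_cmul[OF lin(1)])
    show "B x (T e) = (\<Sum>d\<in>E. g (T e) d * B x d)"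
      by (subst T_e) (simp add: linear_sum[OF lin(2)] linear_cmul[OF lin(2)])
  qed
  have "(\<Sum>e\<in>E. B (T e) e + B e (T e))
      = (\<Sum>e\<in>E. \<Sum>d\<in>E. g (T e) d * B d e) + (\<Sum>e\<in>E. \<Sum>d\<in>E. g (T e) d * B e d)"
    by (simp add: l r sum.distrib)
  \<comment> \<open>Exchanging the indices in the first sum collects the symmetrized coefficients,
    to which conformality applies.\<close>
  also have "\<dots> = (\<Sum>e\<in>E. \<Sum>d\<in>E. (g (T d) e + g d (T e)) * B e d)"
    by (subst sum.swap) (simp add: sum.distrib[symmetric] distrib_right g_sym[of _ "T _"])
  also have "\<dots> = (\<Sum>e\<in>E. \<Sum>d\<in>E. if d = e then 2 * c * B e e else 0)"
    using onb_mem[OF E] onb_g[OF E] by (intro sum.cong) (auto simp: conformal)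
  finally show ?thesis using onb_finite[OF E] by (simp add: sum_distrib_left)
qed

end

section \<open>Conformal factors of a linear map\<close>

text \<open>Each such \<open>c\<close> is a root of the characteristic polynomial of
  \<open>M\<close>, which is monic and hence nonzero. An enumeration \<open>h\<close> of
  \<open>I\<close> supplies the matrix indices.\<close>

lemma finite_eigenvalues:
  fixes M :: "'i \<Rightarrow> 'i \<Rightarrow> real"
  assumes I: "finite I"
  shows "finite {c. \<exists>f. (\<exists>i\<in>I. f i \<noteq> 0) \<and> (\<forall>i\<in>I. (\<Sum>j\<in>I. M i j * f j) = c * f i)}"
    (is "finite ?S")
proof -
  define n where "n = card I"
  obtain h where h: "bij_betw h {0..<n} I"
    using ex_bij_betw_nat_finite[OF I] unfolding n_def by blast
  define A where "A = mat n n (\<lambda>(i, j). M (h i) (h j))"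
  have A: "A \<in> carrier_mat n n" by (simp add: A_def)
  have "poly (char_poly A) c = 0" if "c \<in> ?S" for c
  proof -
    obtain f where nonzero: "\<exists>i\<in>I. f i \<noteq> 0"
      and eigen: "\<And>i. i \<in> I \<Longrightarrow> (\<Sum>j\<in>I. M i j * f j) = c * f i"
      using \<open>c \<in> ?S\<close> by blast
    define v where "v = Matrix.vec n (\<lambda>k. f (h k))"
    have "v \<noteq> 0\<^sub>v n"
    proof -
      obtain k where "k < n" "f (h k) \<noteq> 0"
        using nonzero h by (metis atLeastLessThan_iff bij_betw_iff_bijections)
      then show ?thesis unfolding v_def by (metis index_vec index_zero_vec(1))
    qed
    moreover have "A *\<^sub>v v = c \<cdot>\<^sub>v v"
    proof (rule eq_vecI)
      fix i assume "i < dim_vec (c \<cdot>\<^sub>v v)"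
      then have i: "i < n" by (simp add: v_def)
      have "(A *\<^sub>v v) $ i = (\<Sum>k = 0..<n. M (h i) (h k) * f (h k))"
        using i by (simp add: A_def v_def scalar_prod_def)
      also have "\<dots> = (\<Sum>j\<in>I. M (h i) j * f j)" by (rule sum.reindex_bij_betw[OF h])
      also have "\<dots> = c * f (h i)" using i h by (intro eigen) (auto simp: bij_betw_def)
      finally show "(A *\<^sub>v v) $ i = (c \<cdot>\<^sub>v v) $ i" using i by (simp add: v_def)
    qed (simp add: A_def v_def)
    ultimately have "eigenvalue A c"
      using A by (auto simp: eigenvalue_def eigenvector_def v_def intro!: exI[of _ v])
    then show ?thesis by (simp add: eigenvalue_root_char_poly[OF A])
  qed
  moreover have "char_poly A \<noteq> 0" using degree_monic_char_poly[OF A] by auto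
  ultimately show ?thesis
    by (intro finite_subset[OF _ poly_roots_finite[of "char_poly A"]]) auto
qed

text \<open>Whatever \<open>g\<close> and \<open>U\<close> are, the inverse metric of
  \<open>U\<close> is an eigenvector, with eigenvalue \<open>2 * c\<close>, of T \<otimes> 1 + 1
  \<otimes> T, which depends on \<open>T\<close> alone.\<close>

lemma finite_conformal_factors:
  fixes T :: "'a::real_vector \<Rightarrow> 'a"
  assumes fd: "\<exists>B::'a set. finite B \<and> span B = UNIV" and T: "linear T"
  shows "finite {c. \<exists>g U. inner_product g \<and> subspace U \<and> U \<noteq> {0} \<and> (\<forall>x\<in>U. T x \<in> U) \<and>
    (\<forall>x\<in>U. \<forall>y\<in>U. g (T x) y + g x (T y) = 2 * c * g x y)}" (is "finite ?S")
proof -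
  obtain B :: "'a set" where B: "independent B" "span B = UNIV"
    using real_vector.basis_exists[of UNIV] by (metis top.extremum_uniqueI)
  have fin: "finite B" by (rule independent_spanning_finite[OF fd B(1)])
  define r where "r = representation B"
  have r_lin: "linear (\<lambda>x. r x a)" for a
    unfolding r_def using B
    by (intro linearI) (simp_all add: real_vector.representation_add real_vector.representation_scale)
  have r_expand: "(\<Sum>b\<in>B. r x b *\<^sub>R b) = x" for x
    unfolding r_def using real_vector.sum_representation_eq[OF B(1) _ fin] B(2) by simp
  have r_T: "r (T x) a = (\<Sum>b\<in>B. r x b * r (T b) a)" for x a
  proof -
    have "r (T (\<Sum>b\<in>B. r x b *\<^sub>R b)) a = (\<Sum>b\<in>B. r x b * r (T b) a)"
      by (simp add: linear_sum[OF T] linear_cmul[OF T] linear_sum[OF r_lin] linear_cmul[OF r_lin])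
    then show ?thesis by (simp add: r_expand)
  qed
  \<comment> \<open>\<open>M\<close> is the matrix of T \<otimes> 1 + 1 \<otimes> T in the tensor
    basis indexed by \<open>B \<times> B\<close>.\<close>
  define M where "M = (\<lambda>(a, b) (a', b').
    (if b' = b then r (T a') a else 0) + (if a' = a then r (T b') b else 0))"
  define S where "S = {d. \<exists>f. (\<exists>i\<in>B \<times> B. f i \<noteq> 0) \<and>
    (\<forall>i\<in>B \<times> B. (\<Sum>j\<in>B \<times> B. M i j * f j) = d * f i)}"
  have "2 * c \<in> S" if "c \<in> ?S" for c
  proof -
    obtain g U where g: "inner_product g" and U: "subspace U" "U \<noteq> {0}"
      and TU: "\<And>x. x \<in> U \<Longrightarrow> T x \<in> U"
      and conformal: "\<And>x y. x \<in> U \<Longrightarrow> y \<in> U \<Longrightarrow> g (T x) y + g x (T y) = 2 * c * g x y"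
      using \<open>c \<in> ?S\<close> by blast
    interpret fd_inner_product g by standard (fact fd, fact g)
    obtain E where E: "onb E U" using onb_exists[OF U(1)] by blast
    \<comment> \<open>\<open>f\<close> lists the coordinates of \<Sum> e \<otimes> e, the inverse
      metric of \<open>U\<close>.\<close>
    define f where "f = (\<lambda>(a, b). \<Sum>e\<in>E. r e a * r e b)"
    have "\<exists>e\<in>E. e \<noteq> 0"
    proof -
      obtain x where x: "x \<in> U" "x \<noteq> 0" using U subspace_0 by blast
      then obtain e where "e \<in> E" using onb_expand[OF E x(1)] by fastforce
      moreover have "e \<noteq> 0" using onb_g[OF E \<open>e \<in> E\<close> \<open>e \<in> E\<close>] by (auto simp: g_simps)
      ultimately show ?thesis by blast
    qed
    then obtain e where e: "e \<in> E" "e \<noteq> 0" by blast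
    have "\<exists>b\<in>B. r e b \<noteq> 0"
    proof (rule ccontr)
      assume "\<not> ?thesis"
      then show False using r_expand[of e] e(2) by simp
    qed
    then obtain b where b: "b \<in> B" "r e b \<noteq> 0" by blast
    \<comment> \<open>A diagonal coordinate of this tensor is a sum of squares, one of which is
      positive.\<close>
    have "0 < (r e b)\<^sup>2" using b by simp
    also have "\<dots> \<le> (\<Sum>e\<in>E. (r e b)\<^sup>2)" using e onb_finite[OF E] by (intro member_le_sum) auto
    finally have "f (b, b) \<noteq> 0" by (simp add: f_def power2_eq_square)
    moreover have "(\<Sum>j\<in>B \<times> B. M (a, b) j * f j) = 2 * c * f (a, b)" if "a \<in> B" "b \<in> B" for a b
    proof -
      have "(\<Sum>j\<in>B \<times> B. M (a, b) j * f j)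
          = (\<Sum>a'\<in>B. \<Sum>b'\<in>B. (if b' = b then r (T a') a * f (a', b') else 0)
              + (if a' = a then r (T b') b * f (a', b') else 0))"
        unfolding sum.cartesian_product by (intro sum.cong) (auto simp: M_def distrib_right)
      also have "\<dots> = (\<Sum>a'\<in>B. r (T a') a * f (a', b)) + (\<Sum>b'\<in>B. r (T b') b * f (a, b'))"
      proof -
        have "(\<Sum>a'\<in>B. \<Sum>b'\<in>B. if a' = a then r (T b') b * f (a', b') else 0)
            = (\<Sum>b'\<in>B. r (T b') b * f (a, b'))"
          by (subst sum.swap) (simp add: fin that)
        then show ?thesis by (simp add: sum.distrib fin that)
      qed
      also have "(\<Sum>a'\<in>B. r (T a') a * f (a', b)) = (\<Sum>e\<in>E. r (T e) a * r e b)"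
      proof -
        have "(\<Sum>e\<in>E. r (T e) a * r e b) = (\<Sum>e\<in>E. (\<Sum>a'\<in>B. r e a' * r (T a') a) * r e b)"
          by (rule sum.cong[OF refl], subst r_T, rule refl)
        also have "\<dots> = (\<Sum>a'\<in>B. r (T a') a * f (a', b))"
          by (simp add: f_def sum_distrib_left sum_distrib_right, subst sum.swap) (simp add: mult_ac)
        finally show ?thesis ..
      qed
      also have "(\<Sum>b'\<in>B. r (T b') b * f (a, b')) = (\<Sum>e\<in>E. r e a * r (T e) b)"
      proof -
        have "(\<Sum>e\<in>E. r e a * r (T e) b) = (\<Sum>e\<in>E. r e a * (\<Sum>b'\<in>B. r e b' * r (T b') b))"
          by (rule sum.cong[OF refl], subst r_T, rule refl)
        also have "\<dots> = (\<Sum>b'\<in>B. r (T b') b * f (a, b'))"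
          by (simp add: f_def sum_distrib_left sum_distrib_right, subst sum.swap) (simp add: mult_ac)
        finally show ?thesis ..
      qed
      also have "(\<Sum>e\<in>E. r (T e) a * r e b) + (\<Sum>e\<in>E. r e a * r (T e) b) = 2 * c * f (a, b)"
      proof -
        have "bilinear (\<lambda>x y. r x a * r y b)"
          unfolding bilinear_def
          by (auto intro!: linearI simp: linear_add[OF r_lin] linear_cmul[OF r_lin] algebra_simps)
        from conformal_sum[OF E TU conformal this] show ?thesis by (simp add: f_def sum.distrib)
      qed
      finally show ?thesis .
    qed
    ultimately show ?thesis unfolding S_def using b(1) by auto
  qed
  then have "?S \<subseteq> (\<lambda>d. d / 2) ` S" by (auto intro!: image_eqI[of _ _ "2 * _"])
  moreover have "finite S" unfolding S_def using fin by (intro finite_eigenvalues) simp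
  ultimately show ?thesis by (rule finite_subset[OF _ finite_imageI])
qed

section \<open>The Weyl connection\<close>

locale weyl_lie_algebra = fd_lie_algebra bracket
  for bracket :: "'a::real_vector \<Rightarrow> 'a \<Rightarrow> 'a" +
  fixes g :: "'a \<Rightarrow> 'a \<Rightarrow> real" and \<theta> :: "'a \<Rightarrow> real"
  assumes inner_product: "inner_product g" and closed: "closed_1form bracket \<theta>"
begin

sublocale fd_inner_product g
  by standard (fact finite_dim, fact inner_product)

abbreviation D :: "'a \<Rightarrow> 'a \<Rightarrow> 'a" where
  "D \<equiv> weyl_connection bracket g \<theta>"

lemma linear_theta: "linear \<theta>"
  using closed by (simp add: closed_1form_def)

lemma theta_bracket: "\<theta> (bracket x y) = 0"
proof -
  have "bracket x y \<in> derived_algebra bracket"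
    unfolding derived_algebra_def by (intro span_base) blast
  then show ?thesis using closed by (simp add: closed_1form_def)
qed

lemmas theta_simps = linear_add[OF linear_theta] linear_cmul[OF linear_theta]
  linear_diff[OF linear_theta] linear_neg[OF linear_theta] linear_0[OF linear_theta]

lemmas bracket_simps = bilinear_ladd[OF bilinear] bilinear_radd[OF bilinear]
  bilinear_lmul[OF bilinear] bilinear_rmul[OF bilinear]
  bilinear_lsub[OF bilinear] bilinear_rsub[OF bilinear]

lemma bracket_swap: "bracket y x = - bracket x y"
proof -
  have "bracket (x + y) (x + y) = bracket y x + bracket x y"
    unfolding bracket_simps by (simp add: alternating)
  then show ?thesis by (simp add: alternating eq_neg_iff_add_eq_0)
qed

lemma g_sharp_theta: "g (sharp g \<theta>) z = \<theta> z"
  by (rule g_sharp[OF finite_dim inner_product linear_theta])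

text \<open>Pairing with \<open>z\<close> removes the dual vectors; by
  \<open>g_nondegenerate\<close>, identities for \<open>D\<close> then become scalar
  computations.\<close>

lemma g_D: "g (D x y) z = 1/2 * (g (bracket x y) z - g (bracket x z) y - g (bracket y z) x)
    + \<theta> x * g y z + \<theta> y * g x z - g x y * \<theta> z"
  unfolding weyl_connection_def
  by (simp only: g_simps g_levi_civita[OF inner_product] g_sharp_theta real_scaleR_def)

lemma D_bilinear: "bilinear D"
  unfolding bilinear_def
  by (intro conjI allI linearI g_nondegenerate)
    (simp_all add: g_D g_simps bracket_simps theta_simps algebra_simps add_divide_distrib diff_divide_distrib)

lemmas D_simps = bilinear_ladd[OF D_bilinear] bilinear_radd[OF D_bilinear]
  bilinear_lmul[OF D_bilinear] bilinear_rmul[OF D_bilinear]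
  bilinear_lsub[OF D_bilinear] bilinear_rsub[OF D_bilinear]

lemma linear_D: "linear (D x)" "linear (\<lambda>x. D x y)"
  using D_bilinear by (auto simp: bilinear_def)

lemma D_torsion_free: "bracket x y = D x y - D y x"
proof (rule g_nondegenerate)
  fix z
  show "g (bracket x y) z = g (D x y - D y x) z"
    by (simp add: g_simps g_D bracket_swap[of y x] g_sym[of y x] field_simps)
qed

text \<open>\<open>D x\<close> is \<theta> \<open>x\<close> times the identity plus a skew map:
  besides the Levi-Civita part,
  \<open>\<theta> y *\<^sub>R x - g x y *\<^sub>R sharp g \<theta>\<close> is skew as a map of
  \<open>y\<close>.\<close>

lemma D_conformal: "g (D x y) z + g y (D x z) = 2 * \<theta> x * g y z"
  by (simp add: g_sym[of y "D x z"] g_D bracket_swap[of z y] g_simps g_sym[of z y] field_simps)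

text \<open>Since \<open>D\<close> is torsion-free, closedness of \<theta> means that its covariant
  derivative is symmetric.\<close>

lemma theta_D_commute: "\<theta> (D x y) = \<theta> (D y x)"
  using theta_bracket[of x y] by (simp add: D_torsion_free theta_simps)

section \<open>Curvature of the Weyl connection\<close>

definition curvature :: "'a \<Rightarrow> 'a \<Rightarrow> 'a \<Rightarrow> 'a" where
  "curvature x y z = D x (D y z) - D y (D x z) - D (bracket x y) z"

lemma curvature_swap: "curvature y x z = - curvature x y z"
  by (simp add: curvature_def bracket_swap[of x y] bilinear_lneg[OF D_bilinear])

lemma curvature_bianchi: "curvature x y z + curvature y z x + curvature z x y = 0"
proof -
  have "curvature x y z + curvature y z x + curvature z x y
      = (D x (D y z - D z y) - D (bracket y z) x) + (D y (D z x - D x z) - D (bracket z x) y)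
        + (D z (D x y - D y x) - D (bracket x y) z)"
    unfolding curvature_def by (simp add: D_simps)
  then show ?thesis by (simp only: D_torsion_free[symmetric] jacobi)
qed

text \<open>\<open>D x\<close> and \<open>D y\<close> are skew up to multiples of the identity,
  which drop out of the commutator; \<open>D (bracket x y)\<close> is skew because \<theta> vanishes
  on brackets.\<close>

lemma curvature_skew: "g (curvature x y z) w = - g z (curvature x y w)"
proof -
  have second: "g (D x (D y z)) w
      = 2 * \<theta> x * g (D y z) w - 2 * \<theta> y * g z (D x w) + g z (D y (D x w))" for x y
    using D_conformal[of x "D y z" w] D_conformal[of y z "D x w"] by simp
  have "2 * \<theta> x * g (D y z) w + 2 * \<theta> x * g z (D y w) = 2 * \<theta> x * (2 * \<theta> y * g z w)"
    "2 * \<theta> y * g (D x z) w + 2 * \<theta> y * g z (D x w) = 2 * \<theta> y * (2 * \<theta> x * g z w)"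
    by (simp_all only: distrib_left[symmetric] D_conformal)
  then have "g (D x (D y z)) w - g (D y (D x z)) w = g z (D y (D x w)) - g z (D x (D y w))"
    unfolding second by (simp add: algebra_simps)
  moreover have "g (D (bracket x y) z) w = - g z (D (bracket x y) w)"
    using D_conformal[of "bracket x y" z w] by (simp add: theta_bracket)
  ultimately show ?thesis by (simp add: curvature_def g_simps)
qed

end

section \<open>Proper LCP structures on unimodular Lie algebras\<close>

locale unimodular_lcp = weyl_lie_algebra bracket g \<theta>
  for bracket :: "'a::real_vector \<Rightarrow> 'a \<Rightarrow> 'a" and g \<theta> +
  fixes U :: "'a set"
  assumes unimodular: "unimodular bracket"
    and flat: "flat_subspace bracket g \<theta> U"
    and proper: "U \<noteq> UNIV"
    and theta_nonzero: "\<theta> \<noteq> (\<lambda>x. 0)"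
begin

section \<open>Vanishing of \<theta> on \<open>U\<close>\<close>

lemma subspace_U: "subspace U"
  and D_mem: "u \<in> U \<Longrightarrow> D x u \<in> U"
  and curvature_flat: "u \<in> U \<Longrightarrow> curvature x y u = 0"
  using flat by (auto simp: flat_subspace_def lie_representation_on_def curvature_def)

text \<open>The traceless map \<open>bracket x\<close> is \<open>D x\<close> minus z \<mapsto>
  \<open>D z x\<close>. The former has diagonal entries \<theta> \<open>x\<close>; the latter has
  values in \<open>U\<close>, so only \<open>E\<close> contributes to its trace.\<close>

lemma unimodular_trace:
  assumes E: "onb E U" and F: "onb F (orthogonal_complement U)" and x: "x \<in> U"
  shows "(\<Sum>e\<in>E. g (D e x) e) = (real (card E) + real (card F)) * \<theta> x"
proof -
  have diag: "g (bracket x c) c = \<theta> x * g c c - g (D c x) c" for c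
    using D_conformal[of x c c] by (simp add: D_torsion_free g_simps g_sym[of c "D x c"])
  have "(\<Sum>c\<in>E. g (bracket x c) c) = (\<Sum>c\<in>E. \<theta> x - g (D c x) c)"
    using onb_g[OF E] by (intro sum.cong) (simp_all add: diag)
  moreover have "(\<Sum>c\<in>F. g (bracket x c) c) = (\<Sum>c\<in>F. \<theta> x)"
    using onb_g[OF F] onb_mem[OF F] D_mem[OF x]
    by (intro sum.cong) (simp_all add: diag orthogonal_complement_def)
  moreover have "(\<Sum>c\<in>E \<union> F. g (bracket x c) c) = 0"
    using onb_trace[OF onb_union_complement(2)[OF E F], of "bracket x"] unimodular bilinear
    by (simp add: unimodular_def bilinear_def)
  ultimately show ?thesis
    by (simp add: sum.union_disjoint[OF onb_finite[OF E] onb_finite[OF F] onb_union_complement(1)[OF E F]]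
        sum_subtractf algebra_simps)
qed

text \<open>Let \<open>h\<close> be the vector of \<open>U\<close> dual to the restriction of \<open>\<theta>\<close>. The map
  \<open>R = (\<lambda>z. D z h)\<close> is symmetric on \<open>U\<close>, has trace \<open>n |h|\<^sup>2\<close> by unimodularity, and \<open>R\<^sup>2\<close> has trace
  \<open>n |h|\<^sup>4\<close> by flatness, where \<open>n\<close> is the dimension of the Lie algebra. By Cauchy-Schwarz this
  forces \<open>n \<le> dim U\<close> unless \<open>h = 0\<close>.\<close>

lemma theta_vanishes:
  assumes "x \<in> U"
  shows "\<theta> x = 0"
proof -
  obtain E where E: "onb E U" using onb_exists[OF subspace_U] by blast
  obtain F where F: "onb F (orthogonal_complement U)"
    using onb_exists[OF subspace_orthogonal_complement] by blast
  define q n where "q = real (card E)" and "n = real (card E) + real (card F)"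
  \<comment> \<open>Properness of \<open>U\<close> gives a nonzero complement, hence the strict
    inequality \<open>n > q\<close> behind the final estimate.\<close>
  have "F \<noteq> {}"
  proof
    assume "F = {}"
    then have "onb E UNIV" using onb_union_complement(2)[OF E F] by simp
    then have "(\<Sum>e\<in>E. g x e *\<^sub>R e) = x" for x by (simp add: onb_expand)
    moreover have "(\<Sum>e\<in>E. g x e *\<^sub>R e) \<in> U" for x
      using subspace_U onb_mem[OF E] by (intro subspace_sum subspace_scale) auto
    ultimately have "x \<in> U" for x by metis
    then show False using proper by blast
  qed
  then have "n > q" using onb_finite[OF F] by (simp add: n_def q_def card_gt_0_iff)
  define h where "h = (\<Sum>e\<in>E. \<theta> e *\<^sub>R e)"
  define R where "R = (\<lambda>z. D z h)"
  have h: "h \<in> U"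
    unfolding h_def using subspace_U onb_mem[OF E] by (intro subspace_sum subspace_scale) auto
  have g_h: "g h w = \<theta> w" if "w \<in> U" for w
  proof -
    have "\<theta> w = \<theta> (\<Sum>e\<in>E. g w e *\<^sub>R e)" using onb_expand[OF E that] by simp
    also have "\<dots> = g h w"
      unfolding h_def g_sum_left by (simp add: linear_sum[OF linear_theta] theta_simps g_simps g_sym[of w] mult.commute)
    finally show ?thesis by simp
  qed
  have R: "linear R" "\<And>z. R z \<in> U" using linear_D D_mem[OF h] by (simp_all add: R_def)
  \<comment> \<open>For \<open>z\<close> and \<open>w\<close> in \<open>U\<close> the right side is
    symmetric, by closedness of \<theta>.\<close>
  have "g (R z) w = 2 * \<theta> z * \<theta> w - \<theta> (D z w)" if "w \<in> U" for z w
    using D_conformal[of z h w] g_h[OF that] g_h[OF D_mem[OF that]] by (simp add: R_def)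
  then have R_sym: "g (R z) w = g z (R w)" if "z \<in> U" "w \<in> U" for z w
    using that by (simp add: g_sym[of z] theta_D_commute[of z] mult.commute)
  define s where "s = \<theta> h"
  have "(\<Sum>e\<in>E. g (R e) e) = n * s"
    using unimodular_trace[OF E F h] by (simp add: R_def n_def s_def)
  \<comment> \<open>The trace identity is applied to \<open>D h h\<close>, on which \<theta> takes
    the value \<open>s\<^sup>2\<close>. Flatness rewrites the trace, and the commutator of
    \<open>D h\<close> and \<open>R\<close> contributes zero.\<close>
  moreover have "(\<Sum>e\<in>E. g (R e) (R e)) = n * s\<^sup>2"
  proof -
    have "\<theta> (D h h) = s\<^sup>2"
      using D_conformal[of h h h] g_h[OF D_mem[OF h, of h]] g_h[OF h]
      by (simp add: s_def power2_eq_square g_sym[of "D h h"])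
    then have "n * s\<^sup>2 = (\<Sum>e\<in>E. g (D e (D h h)) e)"
      using unimodular_trace[OF E F D_mem[OF h, of h]] by (simp add: n_def)
    also have "\<dots> = (\<Sum>e\<in>E. g (D h (R e)) e + g (R (R e)) e - g (R (D h e)) e)"
    proof (intro sum.cong refl)
      fix e
      have "D e (D h h) = D h (R e) + D (bracket e h) h"
        using curvature_flat[OF h, of e h] by (simp add: curvature_def R_def algebra_simps)
      also have "D (bracket e h) h = R (R e) - R (D h e)"
        by (simp add: R_def D_torsion_free[of e h] D_simps)
      finally show "g (D e (D h h)) e = g (D h (R e)) e + g (R (R e)) e - g (R (D h e)) e"
        by (simp add: g_simps)
    qed
    also have "\<dots> = (\<Sum>e\<in>E. g (R (R e)) e)"
      using onb_trace_commute[OF E linear_D(1)[of h] D_mem R]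
      by (simp add: sum.distrib sum_subtractf)
    also have "\<dots> = (\<Sum>e\<in>E. g (R e) (R e))"
      using R_sym R(2) onb_mem[OF E] by (intro sum.cong) auto
    finally show ?thesis by simp
  qed
  \<comment> \<open>Cauchy-Schwarz for \<open>R e\<close> and the unit vector \<open>e\<close>; a
    second application bounds the squared sum of the \<open>q\<close> diagonal entries.\<close>
  moreover have "(g (R e) e)\<^sup>2 \<le> g (R e) (R e)" if "e \<in> E" for e
    using g_nonneg[of "R e - g (R e) e *\<^sub>R e"] onb_g[OF E that that]
    by (simp add: g_simps g_sym[of e "R e"] power2_eq_square)
  ultimately have "(n * s)\<^sup>2 \<le> n * s\<^sup>2 * q"
    using sum_squared_le_sum_of_squares[of "\<lambda>e. g (R e) e" E]
      sum_mono[of E "\<lambda>e. (g (R e) e)\<^sup>2" "\<lambda>e. g (R e) (R e)"]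
      mult_right_mono[of _ "n * s\<^sup>2" q]
    by (fastforce simp: q_def)
  then have "n * (n - q) * s\<^sup>2 \<le> 0" by (simp add: power2_eq_square algebra_simps)
  moreover have "n * (n - q) > 0" using \<open>n > q\<close> by (simp add: q_def)
  ultimately have "s = 0" by (simp add: mult_le_0_iff[of "n * (n - q)"])
  then have "h = 0" using g_h[OF h] by (simp add: s_def g_eq_0_iff)
  then show ?thesis using g_h[OF assms] by (simp add: g_simps)
qed

section \<open>Vanishing of \<open>D x\<close> for \<open>x\<close> in \<open>U\<close>\<close>

lemma D_sharp_theta:
  assumes "x \<in> U"
  shows "D x (sharp g \<theta>) = 0"
proof (rule g_nondegenerate)
  fix y
  \<comment> \<open>\<theta> agrees on \<open>D x y\<close> and \<open>D y x\<close>, and the latter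
    lies in \<open>U\<close>, where \<theta> vanishes.\<close>
  have "\<theta> (D x y) = 0"
    by (simp add: theta_D_commute[of x] theta_vanishes D_mem assms)
  then show "g (D x (sharp g \<theta>)) y = g 0 y"
    using D_conformal[of x "sharp g \<theta>" y] by (simp add: g_sharp_theta theta_vanishes assms g_simps)
qed

text \<open>The trilinear form \<open>g (curvature x y z) w\<close> is symmetric in \<open>y, z\<close> by the Bianchi identity and
  skew in \<open>z, w\<close>, hence zero.\<close>

lemma curvature_zero:
  assumes "x \<in> U"
  shows "curvature x y z = 0"
proof (rule g_nondegenerate)
  fix w
  have sym: "curvature x y z = curvature x z y" for y z
  proof -
    have "curvature x y z = - curvature z x y"
      using curvature_bianchi[of x y z] curvature_flat[OF assms, of y z]
      by (simp add: eq_neg_iff_add_eq_0)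
    then show ?thesis by (simp add: curvature_swap[of x z y])
  qed
  have skew: "g (curvature x y z) w = - g (curvature x y w) z" for y z w
    by (subst curvature_skew) (simp add: g_sym)
  \<comment> \<open>Alternating three swaps of the last two of \<open>y, z, w\<close> with three
    swaps of the first two restores the order with total sign -1.\<close>
  show "g (curvature x y z) w = g 0 w"
    using skew[of y z w] skew[of w y z] skew[of z w y] sym[of y w] sym[of w z] sym[of z y]
    by (simp add: g_simps)
qed

text \<open>With \<open>t\<close> dual to \<open>\<theta>\<close>, the form \<open>b x y = tr ((D x)\<^sup>T D y)\<close> on \<open>U\<close> satisfies
  \<open>b x (D t x) = 0\<close>, because \<open>D (D t x) = [D t, D x]\<close>. Since \<open>D t\<close> is conformal with the nonzero factor
  \<open>\<theta> t\<close>, the trace of \<open>b\<close> vanishes.\<close>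

lemma D_zero:
  assumes "x \<in> U"
  shows "D x y = 0"
proof -
  obtain E where E: "onb E U" using onb_exists[OF subspace_U] by blast
  obtain C where C: "onb C UNIV" using onb_exists[OF subspace_UNIV] by blast
  define t where "t = sharp g \<theta>"
  have "t \<noteq> 0"
    using g_sharp_theta theta_nonzero by (auto simp: t_def g_simps)
  then have "\<theta> t > 0" using g_sharp_theta[of t] g_pos[of t] by (simp add: t_def)
  define b where "b = (\<lambda>x y. \<Sum>a\<in>C. g (D x a) (D y a))"
  have "bilinear b"
    unfolding bilinear_def b_def
    by (intro conjI allI linearI) (simp_all add: D_simps g_simps sum.distrib sum_distrib_left)
  then have "(\<Sum>e\<in>E. b (D t e) e + b e (D t e)) = 2 * \<theta> t * (\<Sum>e\<in>E. b e e)"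
    by (intro conformal_sum[OF E] D_mem D_conformal)
  moreover have "b (D t e) e + b e (D t e) = 0" if "e \<in> E" for e
  proof -
    have e: "e \<in> U" by (rule onb_mem[OF E that])
    \<comment> \<open>Since \<open>D e t\<close> vanishes, \<open>D t e\<close> is a bracket, and
      zero curvature turns \<open>D (D t e)\<close> into a commutator.\<close>
    have "D t e = - bracket e t"
      using D_torsion_free[of e t] D_sharp_theta[OF e] by (simp add: t_def)
    then have commutator: "D (D t e) a = D t (D e a) - D e (D t a)" for a
      using curvature_zero[OF e, of t a]
      by (simp add: curvature_def bilinear_lneg[OF D_bilinear] algebra_simps)
    \<comment> \<open>Both sums equal \<open>2 * \<theta> t * b e e\<close>: the first termwise by
      conformality of \<open>D t\<close>, the second by \<open>conformal_sum\<close> for the basis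
      \<open>C\<close>.\<close>
    have "b (D t e) e + b e (D t e)
        = (\<Sum>a\<in>C. g (D t (D e a)) (D e a) + g (D e a) (D t (D e a)))
          - (\<Sum>a\<in>C. g (D e (D t a)) (D e a) + g (D e a) (D e (D t a)))"
      by (simp add: b_def commutator g_simps sum.distrib sum_subtractf)
    also have "(\<Sum>a\<in>C. g (D t (D e a)) (D e a) + g (D e a) (D t (D e a))) = 2 * \<theta> t * b e e"
      by (simp add: D_conformal b_def sum_distrib_left)
    also have "(\<Sum>a\<in>C. g (D e (D t a)) (D e a) + g (D e a) (D e (D t a))) = 2 * \<theta> t * b e e"
    proof -
      have "bilinear (\<lambda>x y. g (D e x) (D e y))"
        unfolding bilinear_def by (intro conjI allI linearI) (simp_all add: D_simps g_simps)
      then show ?thesis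
        unfolding b_def by (intro conformal_sum[OF C] D_conformal) simp_all
    qed
    finally show ?thesis by simp
  qed
  ultimately have "(\<Sum>e\<in>E. b e e) = 0" using \<open>\<theta> t > 0\<close> by simp
  moreover have b_nonneg: "b e e \<ge> 0" for e by (simp add: b_def sum_nonneg g_nonneg)
  ultimately have "b e e = 0" if "e \<in> E" for e
    using that onb_finite[OF E] by (simp add: sum_nonneg_eq_0_iff)
  then have "D e a = 0" if "e \<in> E" "a \<in> C" for e a
    using that onb_finite[OF C] by (simp add: b_def sum_nonneg_eq_0_iff g_nonneg g_eq_0_iff)
  then have "D (\<Sum>e\<in>E. g x e *\<^sub>R e) (\<Sum>a\<in>C. g y a *\<^sub>R a) = 0"
    by (simp add: linear_sum[OF linear_D(1)] linear_sum[OF linear_D(2)] D_simps)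
  then show ?thesis by (simp add: onb_expand[OF E assms] onb_expand[OF C])
qed

text \<open>With \<open>D_mem\<close> and \<open>D_conformal\<close>, this makes \<open>U\<close> an
  ideal on which \<open>bracket y\<close> is conformal with factor \<theta>
  \<open>y\<close>.\<close>

lemma bracket_U:
  assumes "x \<in> U"
  shows "bracket y x = D y x"
  by (simp add: D_torsion_free D_zero[OF assms])

end

section \<open>Finiteness of the set of Lee forms\<close>

theorem theorem6p2:
  fixes bracket :: "'a::real_vector \<Rightarrow> 'a \<Rightarrow> 'a"
  assumes "fd_lie_algebra bracket" and "unimodular bracket"
  shows "finite {\<theta>. closed_1form bracket \<theta> \<and> (\<exists>g U. proper_LCP_structure bracket g \<theta> U)}"
    (is "finite ?L")
proof -
  interpret fd_lie_algebra bracket by fact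
  \<comment> \<open>\<open>S y\<close> ranges over all metrics and invariant subspaces without
    reference to \<theta>, so it serves all LCP structures at once.\<close>
  define S where "S y = {c. \<exists>g U. inner_product g \<and> subspace U \<and> U \<noteq> {0} \<and> (\<forall>x\<in>U. bracket y x \<in> U) \<and>
    (\<forall>x\<in>U. \<forall>z\<in>U. g (bracket y x) z + g x (bracket y z) = 2 * c * g x z)}" for y
  have finite_S: "finite (S y)" for y
    unfolding S_def using bilinear
    by (intro finite_conformal_factors finite_dim) (simp add: bilinear_def)
  have theta_S: "\<theta> y \<in> S y" if "\<theta> \<in> ?L" for \<theta> y
  proof -
    obtain g U where lcp: "proper_LCP_structure bracket g \<theta> U" using \<open>\<theta> \<in> ?L\<close> by blast
    interpret unimodular_lcp bracket g \<theta> U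
      using lcp assms(2)
      by unfold_locales (auto simp: proper_LCP_structure_def LCP_structure_def)
    have "U \<noteq> {0}" using lcp by (simp add: proper_LCP_structure_def LCP_structure_def)
    then show ?thesis
      unfolding S_def mem_Collect_eq
      by (intro exI[of _ g] exI[of _ U])
        (simp add: inner_product subspace_U bracket_U D_mem D_conformal)
  qed
  obtain B :: "'a set" where B: "finite B" "span B = UNIV" using finite_dim by blast
  \<comment> \<open>On a finite spanning set the values of \<theta> form a point of a finite
    product; by linearity they determine \<theta>.\<close>
  have "(\<lambda>\<theta>. restrict \<theta> B) ` ?L \<subseteq> (\<Pi>\<^sub>E y\<in>B. S y)"
    by (rule image_subsetI) (simp add: theta_S)
  then have "finite ((\<lambda>\<theta>. restrict \<theta> B) ` ?L)"
    by (rule finite_subset) (intro finite_PiE B finite_S)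
  moreover have "inj_on (\<lambda>\<theta>. restrict \<theta> B) ?L"
  proof (rule inj_onI)
    fix \<theta> \<eta> assume "\<theta> \<in> ?L" "\<eta> \<in> ?L" and eq: "restrict \<theta> B = restrict \<eta> B"
    then have lin: "linear \<theta>" "linear \<eta>" by (auto simp: closed_1form_def)
    have "\<theta> b = \<eta> b" if "b \<in> B" for b using fun_cong[OF eq, of b] that by simp
    then show "\<theta> = \<eta>" using linear_eq_on_span[OF lin] B(2) by blast
  qed
  ultimately show ?thesis by (rule finite_imageD)
qed

end
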